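(* Let $\mathcal S$ be the class of Schreier split epimorphisms in $\mathbf{RPOGrp}$. For every right-preordered group $X$ there is an isomorphism of functors $\mathbf{RPOGrp}^{\mathrm{op}}\to\mathbf{Set}$ $$\mathcal S\text{-}\mathrm{Pt}(-,X)\;\cong\;\mathbf{RPOGrp}(-,[X]_{\mathcal S}).$$
   Context: Groups are written additively and need not be abelian. A right-preordered group is a pair $(G,P_G)$ with $G$ a group and $P_G$ a submonoid of $G$ (the positive cone). Morphisms $(G,P_G)\to(H,P_H)$ in $\mathbf{RPOGrp}$ are group homomorphisms $f$ with $f(P_G)\subseteq P_H$. Limits are computed separately on groups and on positive cones; in particular the kernel of $f$ is $(\ker f,\ker f\cap P_G)$. A split epimorphism $d:(X_1,P_1)\to(X_0,P_0)$ with section $e$ ($de=\mathrm{id}$) in $\mathbf{RPOGrp}$ is a Schreier split epimorphism if $a-e(d(a))\in P_1$ for all $a\in P_1$. An $\mathcal S$-split extension with codomain $Y$ and kernel $X$ is a Schreier split epimorphism $A\rightleftarrows Y$ together with a kernel $X\to A$ of it. $\mathcal S\text{-}\mathrm{Pt}(Y,X)$ is the set of isomorphism classes of $\mathcal S$-split extensions with codomain $Y$ and kernel $X$ (isomorphisms being isomorphisms of the middle object compatible with all structure maps and inducing identities on $X$ and $Y$); it is a contravariant functor of $Y$ by pulling back. For a right-preordered group $X=(G,P_G)$, $[X]_{\mathcal S}:=(\mathrm{Aut}(G),\mathrm{Aut}(G)_{\le})$, where $\mathrm{Aut}(G)$ is the group of all group automorphisms of $G$ under composition and $\mathrm{Aut}(G)_\le$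 is the submonoid of those $f$ with $f(P_G)\subseteq P_G$ ($f^{-1}$ need not preserve $P_G$). *)

theory Defs
  imports "HOL-Algebra.Coset" "HOL-Algebra.Bij"
begin

text \<open>
  HOL-Algebra writes groups multiplicatively: the sum \<open>a + b\<close> of the (not necessarily abelian)
  groups considered here is \<open>a \<otimes> b\<close>, and \<open>a - b\<close> is \<open>a \<otimes> inv b\<close>.
\<close>

section \<open>The category of right-preordered groups\<close>

record 'a rpogrp = "'a monoid" +
  pos :: "'a set"

locale rpo_group = group G + submonoid "pos G" G
  for G :: "'a rpogrp" (structure)

text \<open>
  Morphisms are normalised to be \<open>undefined\<close> outside the carrier of their domain, so that equality
  of HOL functions is equality of morphisms. The identity of \<open>G\<close> is \<open>\<lambda>x\<in>carrier G. x\<close> and the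
  composite of \<open>f\<close> (with domain \<open>G\<close>) and \<open>g\<close> is \<open>compose (carrier G) g f\<close>.
\<close>

definition rpo_hom :: "'a rpogrp \<Rightarrow> 'b rpogrp \<Rightarrow> ('a \<Rightarrow> 'b) set" where
  "rpo_hom G H = {f \<in> hom G H \<inter> extensional (carrier G). f ` pos G \<subseteq> pos H}"

text \<open>Isomorphisms have an inverse that is again a morphism, i.e. also preserves positive cones.\<close>

definition rpo_iso :: "'a rpogrp \<Rightarrow> 'b rpogrp \<Rightarrow> ('a \<Rightarrow> 'b) set" where
  "rpo_iso G H = {f \<in> rpo_hom G H. \<exists>g \<in> rpo_hom H G.
     (\<forall>x \<in> carrier G. g (f x) = x) \<and> (\<forall>y \<in> carrier H. f (g y) = y)}"

definition rpo_kernel :: "'a rpogrp \<Rightarrow> 'b rpogrp \<Rightarrow> ('a \<Rightarrow> 'b) \<Rightarrow> 'a rpogrp" where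
  "rpo_kernel G H f = G\<lparr>carrier := kernel G H f, pos := kernel G H f \<inter> pos G\<rparr>"

text \<open>The pullback of \<open>f : G \<rightarrow> K\<close> and \<open>g : H \<rightarrow> K\<close>.\<close>

definition rpo_pullback ::
    "'a rpogrp \<Rightarrow> 'b rpogrp \<Rightarrow> ('a \<Rightarrow> 'c) \<Rightarrow> ('b \<Rightarrow> 'c) \<Rightarrow> ('a \<times> 'b) rpogrp" where
  "rpo_pullback G H f g =
     \<lparr>carrier = {(a, b) \<in> carrier G \<times> carrier H. f a = g b},
      mult = mult (G \<times>\<times> H),
      one = one (G \<times>\<times> H),
      pos = {(a, b) \<in> pos G \<times> pos H. f a = g b}\<rparr>"


section \<open>Schreier split epimorphisms and split extensions\<close>

definition schreier_split_epi ::
    "'a rpogrp \<Rightarrow> 'b rpogrp \<Rightarrow> ('a \<Rightarrow> 'b) \<Rightarrow> ('b \<Rightarrow> 'a) \<Rightarrow> bool" where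
  "schreier_split_epi A Y d e \<longleftrightarrow>
     rpo_group A \<and> rpo_group Y \<and> d \<in> rpo_hom A Y \<and> e \<in> rpo_hom Y A \<and>
     (\<forall>y \<in> carrier Y. d (e y) = y) \<and>
     (\<forall>a \<in> pos A. a \<otimes>\<^bsub>A\<^esub> inv\<^bsub>A\<^esub> (e (d a)) \<in> pos A)"

record ('x, 'y, 'a) split_ext =
  mid :: "'a rpogrp"
  proj :: "'a \<Rightarrow> 'y"
  sec :: "'y \<Rightarrow> 'a"
  incl :: "'x \<Rightarrow> 'a"

text \<open>
  That \<open>incl E : X \<rightarrow> mid E\<close> is a kernel of \<open>proj E\<close> means that it factors through an
  isomorphism onto the canonical kernel object (as limits are computed separately on groups and on
  positive cones); since HOL functions carry no codomain, the factorisation is \<open>incl E\<close> itself.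
\<close>

definition S_split_ext :: "'x rpogrp \<Rightarrow> 'y rpogrp \<Rightarrow> ('x, 'y, 'a) split_ext \<Rightarrow> bool" where
  "S_split_ext X Y E \<longleftrightarrow>
     schreier_split_epi (mid E) Y (proj E) (sec E) \<and>
     incl E \<in> rpo_iso X (rpo_kernel (mid E) Y (proj E))"

text \<open>The carriers of the two middle objects may live in different types.\<close>

definition ext_isomorphic :: "'x rpogrp \<Rightarrow> 'y rpogrp \<Rightarrow>
    ('x, 'y, 'a) split_ext \<Rightarrow> ('x, 'y, 'b) split_ext \<Rightarrow> bool" where
  "ext_isomorphic X Y E F \<longleftrightarrow>
     (\<exists>h \<in> rpo_iso (mid E) (mid F).
        (\<forall>a \<in> carrier (mid E). proj F (h a) = proj E a) \<and>
        (\<forall>y \<in> carrier Y. h (sec E y) = sec F y) \<and>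
        (\<forall>x \<in> carrier X. h (incl E x) = incl F x))"

text \<open>
  The pullback of an extension \<open>E\<close> of \<open>Y\<close> by \<open>X\<close> along \<open>f : Z \<rightarrow> Y\<close>, with the structure maps
  induced by the universal property.
\<close>

definition ext_pullback :: "'x rpogrp \<Rightarrow> 'y rpogrp \<Rightarrow> ('y \<Rightarrow> 'y) \<Rightarrow>
    ('x, 'y, 'a) split_ext \<Rightarrow> ('x, 'y, 'y \<times> 'a) split_ext" where
  "ext_pullback X Z f E =
     (let P = rpo_pullback Z (mid E) f (proj E) in
      \<lparr>mid = P,
       proj = restrict fst (carrier P),
       sec = (\<lambda>z \<in> carrier Z. (z, sec E (f z))),
       incl = (\<lambda>x \<in> carrier X. (\<one>\<^bsub>Z\<^esub>, incl E x))\<rparr>)"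


section \<open>Presheaves on right-preordered groups\<close>

text \<open>
  Contravariant set-valued functors on the right-preordered groups with carrier in the type \<open>'y\<close>.
  For \<open>f : Z \<rightarrow> Y\<close>, the induced map \<open>F0 Y \<rightarrow> F0 Z\<close> is \<open>F1 Z Y f\<close>.
\<close>

locale rpo_presheaf =
  fixes F0 :: "'y rpogrp \<Rightarrow> 'v set"
    and F1 :: "'y rpogrp \<Rightarrow> 'y rpogrp \<Rightarrow> ('y \<Rightarrow> 'y) \<Rightarrow> 'v \<Rightarrow> 'v"
  assumes map_closed:
      "\<lbrakk>rpo_group Z; rpo_group Y; f \<in> rpo_hom Z Y; c \<in> F0 Y\<rbrakk> \<Longrightarrow> F1 Z Y f c \<in> F0 Z"
    and map_id:
      "\<lbrakk>rpo_group Y; c \<in> F0 Y\<rbrakk> \<Longrightarrow> F1 Y Y (\<lambda>y \<in> carrier Y. y) c = c"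
    and map_comp:
      "\<lbrakk>rpo_group W; rpo_group Z; rpo_group Y; g \<in> rpo_hom W Z; f \<in> rpo_hom Z Y; c \<in> F0 Y\<rbrakk>
         \<Longrightarrow> F1 W Y (compose (carrier W) f g) c = F1 W Z g (F1 Z Y f c)"

locale rpo_presheaf_iso = F: rpo_presheaf F0 F1 + G: rpo_presheaf G0 G1
  for F0 :: "'y rpogrp \<Rightarrow> 'v set" and F1
    and G0 :: "'y rpogrp \<Rightarrow> 'w set" and G1 +
  fixes \<Phi> :: "'y rpogrp \<Rightarrow> 'v \<Rightarrow> 'w"
  assumes component_bij: "rpo_group Y \<Longrightarrow> bij_betw (\<Phi> Y) (F0 Y) (G0 Y)"
    and natural:
      "\<lbrakk>rpo_group Z; rpo_group Y; f \<in> rpo_hom Z Y; c \<in> F0 Y\<rbrakk>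
         \<Longrightarrow> \<Phi> Z (F1 Z Y f c) = G1 Z Y f (\<Phi> Y c)"

text \<open>
  The functor \<open>\<S>-Pt(-, X)\<close>. In \<open>S_Pt\<close> the middle objects range over all right-preordered groups
  with carrier in the type \<open>'a\<close>. The canonical pullback has its carrier in \<open>'y \<times> 'a\<close> instead;
  \<open>S_Pt_map\<close> takes the isomorphism class of that pullback within \<open>'a\<close>. For this class to be
  nonempty, \<open>'a\<close> must be large enough (an injection of \<open>'x \<times> 'y\<close> into \<open>'a\<close> suffices).
\<close>

definition S_Pt :: "'x rpogrp \<Rightarrow> 'y rpogrp \<Rightarrow> ('x, 'y, 'a) split_ext set set" where
  "S_Pt X Y = {E. S_split_ext X Y E} //
     {(E, F). S_split_ext X Y E \<and> S_split_ext X Y F \<and> ext_isomorphic X Y E F}"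

definition S_Pt_map :: "'x rpogrp \<Rightarrow> 'y rpogrp \<Rightarrow> 'y rpogrp \<Rightarrow> ('y \<Rightarrow> 'y) \<Rightarrow>
    ('x, 'y, 'a) split_ext set \<Rightarrow> ('x, 'y, 'a) split_ext set" where
  "S_Pt_map X Z Y f c =
     {E'. S_split_ext X Z E' \<and> (\<exists>E \<in> c. ext_isomorphic X Z E' (ext_pullback X Z f E))}"

definition hom_map :: "'y rpogrp \<Rightarrow> 'y rpogrp \<Rightarrow> ('y \<Rightarrow> 'y) \<Rightarrow> ('y \<Rightarrow> 'b) \<Rightarrow> ('y \<Rightarrow> 'b)" where
  "hom_map Z Y f \<phi> = compose (carrier Z) \<phi> f"

text \<open>The object \<open>[X]\<close>; \<open>AutoGroup X\<close> is the group of all automorphisms of the underlying group.\<close>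

definition rpo_Aut :: "'x rpogrp \<Rightarrow> ('x \<Rightarrow> 'x) rpogrp" where
  "rpo_Aut X =
     \<lparr>carrier = carrier (AutoGroup X),
      mult = mult (AutoGroup X),
      one = one (AutoGroup X),
      pos = {f \<in> carrier (AutoGroup X). f ` pos X \<subseteq> pos X}\<rparr>"

end

theory Submission
  imports Defs
begin

text \<open>
  In a Schreier split extension \<open>E\<close> every element of the middle object is uniquely
  \<open>incl E x \<otimes> sec E y\<close>, and the Schreier condition says that it is positive iff \<open>x\<close> and \<open>y\<close>
  are. So \<open>E\<close> is determined up to isomorphism by the action of \<open>Y\<close> on \<open>X\<close> by conjugation, which is
  a morphism \<open>Y \<rightarrow> [X]\<close>. Every such morphism is the action of a semidirect product with
  cone \<open>pos X \<times> pos Y\<close>, and pulling back along \<open>f\<close> precomposes the action with \<open>f\<close>.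
\<close>


section \<open>Morphisms of right-preordered groups\<close>

lemma rpo_groupI:
  assumes "group G" "submonoid (pos G) G"
  shows "rpo_group G"
  using assms by (simp add: rpo_group_def)

lemma rpo_homI:
  assumes "f \<in> hom G H" "f \<in> extensional (carrier G)" "\<And>x. x \<in> pos G \<Longrightarrow> f x \<in> pos H"
  shows "f \<in> rpo_hom G H"
  using assms by (auto simp: rpo_hom_def)

lemma rpo_homD:
  assumes "f \<in> rpo_hom G H"
  shows "f \<in> hom G H" "f \<in> extensional (carrier G)" "x \<in> pos G \<Longrightarrow> f x \<in> pos H"
  using assms by (auto simp: rpo_hom_def)

lemma rpo_hom_compose:
  assumes "rpo_group G" "f \<in> rpo_hom G H" "g \<in> rpo_hom H K"
  shows "compose (carrier G) g f \<in> rpo_hom G K"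
proof -
  interpret G: rpo_group G by fact
  have "x \<in> pos G \<Longrightarrow> x \<in> carrier G" for x
    using G.subset by blast
  then show ?thesis
    using assms(2,3) G.group_axioms
    by (auto simp: rpo_hom_def compose_eq group.hom_compose)
qed

text \<open>The inverse morphism is traded for bijectivity plus reflection of the cone. Only
  \<open>G\<close> is assumed to be a group, so the criterion applies to a kernel object as target
  without first showing that it is a group.\<close>

lemma rpo_iso_iff:
  assumes "group G" "pos G \<subseteq> carrier G" "pos H \<subseteq> carrier H"
  shows "f \<in> rpo_iso G H \<longleftrightarrow>
    f \<in> hom G H \<and> f \<in> extensional (carrier G) \<and> bij_betw f (carrier G) (carrier H) \<and>
    (\<forall>x\<in>carrier G. f x \<in> pos H \<longleftrightarrow> x \<in> pos G)" (is "_ \<longleftrightarrow> ?R")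
proof
  assume "f \<in> rpo_iso G H"
  then obtain g where fg: "f \<in> rpo_hom G H" "g \<in> rpo_hom H G"
    "\<forall>x\<in>carrier G. g (f x) = x" "\<forall>y\<in>carrier H. f (g y) = y"
    by (auto simp: rpo_iso_def)
  have "f ` carrier G \<subseteq> carrier H" "g ` carrier H \<subseteq> carrier G"
    using fg(1,2) by (auto simp: rpo_hom_def hom_def)
  then have "bij_betw f (carrier G) (carrier H)"
    using fg(3,4) by (intro bij_betw_byWitness[where f' = g]) auto
  moreover have "\<forall>x\<in>carrier G. f x \<in> pos H \<longleftrightarrow> x \<in> pos G"
    using fg by (metis rpo_homD(3))
  ultimately show ?R
    using rpo_homD[OF fg(1)] by blast
next
  assume R: ?R
  \<comment> \<open>The restriction makes the inverse \<open>undefined\<close> outside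
    \<open>carrier H\<close>, as morphisms require.\<close>
  define g where "g = restrict (inv_into (carrier G) f) (carrier H)"
  have bij: "bij_betw f (carrier G) (carrier H)"
    using R by blast
  have inv: "inv_into (carrier G) f \<in> hom H G"
    using R group.iso_set_sym[OF assms(1)] by (auto simp: iso_def)
  interpret G: group G by fact
  \<comment> \<open>Since \<open>g\<close> is the inverse only on \<open>carrier H\<close>, its
    homomorphism law needs products to stay there; surjectivity of \<open>f\<close> provides
    this.\<close>
  have "y \<otimes>\<^bsub>H\<^esub> z \<in> carrier H" if "y \<in> carrier H" "z \<in> carrier H" for y z
  proof -
    have "y \<in> f ` carrier G" "z \<in> f ` carrier G"
      using that bij by (simp_all add: bij_betw_imp_surj_on)
    then obtain u v where uv: "u \<in> carrier G" "v \<in> carrier G" "y = f u" "z = f v"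
      by blast
    then have "y \<otimes>\<^bsub>H\<^esub> z = f (u \<otimes>\<^bsub>G\<^esub> v)"
      using R by (simp add: hom_mult[of f G H])
    also have "\<dots> \<in> carrier H"
      using R uv by (intro hom_in_carrier[of f G H]) auto
    finally show ?thesis .
  qed
  then have "g \<in> hom H G"
    using inv by (simp add: g_def hom_def Pi_iff)
  moreover have gf: "\<forall>x\<in>carrier G. g (f x) = x" and fg: "\<forall>y\<in>carrier H. f (g y) = y"
    using bij by (auto simp: g_def bij_betw_def bij_betw_inv_into_left bij_betw_inv_into_right f_inv_into_f)
  moreover have "g y \<in> pos G" if "y \<in> pos H" for y
    using that R fg assms(3) \<open>g \<in> hom H G\<close> by (metis hom_in_carrier subsetD)
  ultimately have "g \<in> rpo_hom H G"
    by (intro rpo_homI) (auto simp: g_def)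
  moreover have "f \<in> rpo_hom G H"
    using R assms(2) by (intro rpo_homI) auto
  ultimately show "f \<in> rpo_iso G H"
    using gf fg by (auto simp: rpo_iso_def)
qed

text \<open>The kernel object inherits multiplication and cone from the middle object, so an
  isomorphism onto it can be tested inside \<open>mid E\<close>.\<close>

lemma S_split_ext_iff:
  assumes "rpo_group X"
  shows "S_split_ext X Y E \<longleftrightarrow> schreier_split_epi (mid E) Y (proj E) (sec E) \<and>
    incl E \<in> hom X (mid E) \<and> incl E \<in> extensional (carrier X) \<and> inj_on (incl E) (carrier X) \<and>
    incl E ` carrier X = kernel (mid E) Y (proj E) \<and>
    (\<forall>x\<in>carrier X. incl E x \<in> pos (mid E) \<longleftrightarrow> x \<in> pos X)"
proof -
  interpret X: rpo_group X by fact
  have "incl E \<in> rpo_iso X (rpo_kernel (mid E) Y (proj E)) \<longleftrightarrow>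
    incl E \<in> hom X (mid E) \<and> incl E \<in> extensional (carrier X) \<and> inj_on (incl E) (carrier X) \<and>
    incl E ` carrier X = kernel (mid E) Y (proj E) \<and>
    (\<forall>x\<in>carrier X. incl E x \<in> pos (mid E) \<longleftrightarrow> x \<in> pos X)"
    using X.subset
    by (subst rpo_iso_iff)
       (auto simp: rpo_kernel_def bij_betw_def hom_def kernel_def Pi_iff image_subset_iff)
  then show ?thesis
    by (simp add: S_split_ext_def)
qed

text \<open>Bijectivity need not be listed on the right: the unit and composition laws make
  \<open>\<phi> (inv y)\<close> a two-sided inverse of \<open>\<phi> y\<close>, so an action by
  endomorphisms is one by automorphisms.\<close>

lemma rpo_hom_Aut_iff:
  assumes X: "rpo_group X" and Y: "rpo_group Y"
  shows "\<phi> \<in> rpo_hom Y (rpo_Aut X) \<longleftrightarrow> \<phi> \<in> extensional (carrier Y) \<and>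
    (\<forall>y\<in>carrier Y. \<phi> y \<in> extensional (carrier X) \<inter> hom X X) \<and>
    (\<forall>y\<in>carrier Y. \<forall>z\<in>carrier Y. \<phi> (y \<otimes>\<^bsub>Y\<^esub> z) = compose (carrier X) (\<phi> y) (\<phi> z)) \<and>
    \<phi> \<one>\<^bsub>Y\<^esub> = (\<lambda>x\<in>carrier X. x) \<and>
    (\<forall>y\<in>pos Y. \<forall>x\<in>pos X. \<phi> y x \<in> pos X)" (is "_ \<longleftrightarrow> ?R")
proof
  interpret X: rpo_group X by fact
  interpret Y: rpo_group Y by fact
  assume \<phi>: "\<phi> \<in> rpo_hom Y (rpo_Aut X)"
  have h: "\<phi> \<in> hom Y (AutoGroup X)"
    using rpo_homD(1)[OF \<phi>] by (simp add: rpo_Aut_def hom_def)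
  then have "\<phi> \<one>\<^bsub>Y\<^esub> = \<one>\<^bsub>AutoGroup X\<^esub>"
    using hom_one X.AutoGroup Y.group_axioms by blast
  moreover have "\<phi> y x \<in> pos X" if "y \<in> pos Y" "x \<in> pos X" for y x
    using rpo_homD(3)[OF \<phi> that(1)] that(2) by (auto simp: rpo_Aut_def)
  ultimately show ?R
    using h rpo_homD(2)[OF \<phi>]
    by (auto simp: AutoGroup_def auto_def BijGroup_def hom_def Pi_iff Bij_imp_extensional)
next
  interpret X: rpo_group X by fact
  interpret Y: rpo_group Y by fact
  assume R: ?R
  have id: "\<phi> z (\<phi> y x) = x"
    if "z \<otimes>\<^bsub>Y\<^esub> y = \<one>\<^bsub>Y\<^esub>" "y \<in> carrier Y" "z \<in> carrier Y" "x \<in> carrier X" for y z x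
    using R that by (metis compose_eq restrict_apply')
  have bij: "bij_betw (\<phi> y) (carrier X) (carrier X)" if y: "y \<in> carrier Y" for y
  proof (rule bij_betw_byWitness[where f' = "\<phi> (inv\<^bsub>Y\<^esub> y)"])
    show "\<phi> y ` carrier X \<subseteq> carrier X" "\<phi> (inv\<^bsub>Y\<^esub> y) ` carrier X \<subseteq> carrier X"
      using R y by (auto simp: hom_def Pi_iff)
  qed (use y id in auto)
  then have Bij: "\<phi> y \<in> Bij (carrier X)" if "y \<in> carrier Y" for y
    using R that by (auto simp: Bij_def)
  then have "\<phi> y \<in> auto X" if "y \<in> carrier Y" for y
    using R that by (auto simp: auto_def)
  then show "\<phi> \<in> rpo_hom Y (rpo_Aut X)"
    using R Bij Y.subset
    by (auto simp: rpo_hom_def rpo_Aut_def AutoGroup_def BijGroup_def hom_def)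
qed



lemma rpo_hom_AutD:
  assumes "rpo_group X" "rpo_group Y" "\<phi> \<in> rpo_hom Y (rpo_Aut X)"
  shows "\<lbrakk>y \<in> carrier Y; x \<in> carrier X\<rbrakk> \<Longrightarrow> \<phi> y x \<in> carrier X"
    and "\<lbrakk>y \<in> carrier Y; x \<in> carrier X; x' \<in> carrier X\<rbrakk> \<Longrightarrow> \<phi> y (x \<otimes>\<^bsub>X\<^esub> x') = \<phi> y x \<otimes>\<^bsub>X\<^esub> \<phi> y x'"
    and "y \<in> carrier Y \<Longrightarrow> \<phi> y \<one>\<^bsub>X\<^esub> = \<one>\<^bsub>X\<^esub>"
    and "\<lbrakk>y \<in> carrier Y; z \<in> carrier Y; x \<in> carrier X\<rbrakk> \<Longrightarrow> \<phi> (y \<otimes>\<^bsub>Y\<^esub> z) x = \<phi> y (\<phi> z x)"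
    and "x \<in> carrier X \<Longrightarrow> \<phi> \<one>\<^bsub>Y\<^esub> x = x"
    and "\<lbrakk>y \<in> pos Y; x \<in> pos X\<rbrakk> \<Longrightarrow> \<phi> y x \<in> pos X"
proof -
  have hom: "\<phi> y \<in> hom X X" if "y \<in> carrier Y" for y
    using assms that by (auto simp: rpo_hom_Aut_iff)
  then show "\<lbrakk>y \<in> carrier Y; x \<in> carrier X\<rbrakk> \<Longrightarrow> \<phi> y x \<in> carrier X"
    "\<lbrakk>y \<in> carrier Y; x \<in> carrier X; x' \<in> carrier X\<rbrakk> \<Longrightarrow> \<phi> y (x \<otimes>\<^bsub>X\<^esub> x') = \<phi> y x \<otimes>\<^bsub>X\<^esub> \<phi> y x'"
    by (auto simp: hom_def)
  show "y \<in> carrier Y \<Longrightarrow> \<phi> y \<one>\<^bsub>X\<^esub> = \<one>\<^bsub>X\<^esub>"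
    using hom assms(1) hom_one by (auto simp: rpo_group_def)
qed (use assms in \<open>auto simp: rpo_hom_Aut_iff compose_eq\<close>)

text \<open>Both the action and its values are extensional, so comparison on the two carriers
  suffices.\<close>

lemma rpo_hom_Aut_eqI:
  assumes "rpo_group X" "rpo_group Y" "\<phi> \<in> rpo_hom Y (rpo_Aut X)" "\<psi> \<in> rpo_hom Y (rpo_Aut X)"
    and eq: "\<And>y x. \<lbrakk>y \<in> carrier Y; x \<in> carrier X\<rbrakk> \<Longrightarrow> \<phi> y x = \<psi> y x"
  shows "\<phi> = \<psi>"
proof (rule extensionalityI)
  fix y assume y: "y \<in> carrier Y"
  show "\<phi> y = \<psi> y"
    using assms y by (intro extensionalityI[OF _ _ eq]) (auto simp: rpo_hom_Aut_iff)
qed (use assms(3,4) rpo_homD(2) in auto)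

text \<open>The Schreier condition enters as \<open>a = p + e (d a)\<close> with \<open>p\<close>
  positive; cancelling on the right identifies \<open>p\<close> with the required difference.
  Concrete extensions can thus be checked without computing inverses in the middle object.\<close>

lemma S_split_extI:
  assumes X: "rpo_group X" and A: "rpo_group (mid E)" and Y: "rpo_group Y"
    and d: "proj E \<in> rpo_hom (mid E) Y" and e: "sec E \<in> rpo_hom Y (mid E)"
    and de: "\<And>y. y \<in> carrier Y \<Longrightarrow> proj E (sec E y) = y"
    and pos: "\<And>a. a \<in> pos (mid E) \<Longrightarrow> \<exists>p\<in>pos (mid E). a = p \<otimes>\<^bsub>mid E\<^esub> sec E (proj E a)"
    and k: "incl E \<in> hom X (mid E)" "incl E \<in> extensional (carrier X)" "inj_on (incl E) (carrier X)"
    and dk: "\<And>x. x \<in> carrier X \<Longrightarrow> proj E (incl E x) = \<one>\<^bsub>Y\<^esub>"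
    and ker: "\<And>a. \<lbrakk>a \<in> carrier (mid E); proj E a = \<one>\<^bsub>Y\<^esub>\<rbrakk> \<Longrightarrow> \<exists>x\<in>carrier X. a = incl E x"
    and k_pos: "\<And>x. x \<in> carrier X \<Longrightarrow> incl E x \<in> pos (mid E) \<longleftrightarrow> x \<in> pos X"
  shows "S_split_ext X Y E"
proof -
  interpret A: rpo_group "mid E" by fact
  have "a \<otimes>\<^bsub>mid E\<^esub> inv\<^bsub>mid E\<^esub> (sec E (proj E a)) \<in> pos (mid E)" if a: "a \<in> pos (mid E)" for a
  proof -
    obtain p where p: "p \<in> pos (mid E)" "a = p \<otimes>\<^bsub>mid E\<^esub> sec E (proj E a)"
      using pos a by blast
    have "sec E (proj E a) \<in> pos (mid E)"
      using a d e by (blast intro: rpo_homD(3))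
    then have "a \<otimes>\<^bsub>mid E\<^esub> inv\<^bsub>mid E\<^esub> (sec E (proj E a)) = p"
      using p a A.subset by (subst A.inv_solve_right') auto
    with p show ?thesis
      by simp
  qed
  then have "schreier_split_epi (mid E) Y (proj E) (sec E)"
    using A Y d e de by (simp add: schreier_split_epi_def)
  moreover have "incl E ` carrier X = kernel (mid E) Y (proj E)"
    using dk ker k(1) by (auto simp: kernel_def hom_def)
  ultimately show ?thesis
    using k k_pos X by (simp add: S_split_ext_iff)
qed


section \<open>The action of a Schreier split extension\<close>

text \<open>
  Conjugation by \<open>sec E y\<close>. It preserves the positive cone of \<open>X\<close> for \<open>y\<close> positive although
  \<open>inv (sec E y)\<close> need not be positive: the Schreier condition applies to the positive element
  \<open>sec E y \<otimes> incl E x\<close>.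
\<close>

definition ext_action ::
    "'x rpogrp \<Rightarrow> 'y rpogrp \<Rightarrow> ('x, 'y, 'a) split_ext \<Rightarrow> 'y \<Rightarrow> 'x \<Rightarrow> 'x" where
  "ext_action X Y E = (\<lambda>y\<in>carrier Y. \<lambda>x\<in>carrier X. inv_into (carrier X) (incl E)
     (sec E y \<otimes>\<^bsub>mid E\<^esub> incl E x \<otimes>\<^bsub>mid E\<^esub> inv\<^bsub>mid E\<^esub> (sec E y)))"

locale schreier_ext =
  fixes X :: "'x rpogrp" and Y :: "'y rpogrp" and E :: "('x, 'y, 'a) split_ext"
  assumes rpo_group_X: "rpo_group X" and S_split_ext: "S_split_ext X Y E"
begin

abbreviation "A \<equiv> mid E"
abbreviation "d \<equiv> proj E"
abbreviation "e \<equiv> sec E"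
abbreviation "k \<equiv> incl E"

section \<open>Structure maps and kernel of a Schreier split extension\<close>

lemma schreier: "schreier_split_epi A Y d e"
  using S_split_ext by (simp add: S_split_ext_def)

lemma rpo_groups: "rpo_group A" "rpo_group Y"
  using schreier by (auto simp: schreier_split_epi_def)

lemma rpo_homs: "d \<in> rpo_hom A Y" "e \<in> rpo_hom Y A"
  using schreier by (auto simp: schreier_split_epi_def)

sublocale X: submonoid "pos X" X
  using rpo_group_X by (simp add: rpo_group_def)

sublocale A: submonoid "pos A" A
  using rpo_groups(1) by (simp add: rpo_group_def)

sublocale Y: submonoid "pos Y" Y
  using rpo_groups(2) by (simp add: rpo_group_def)

sublocale d: group_hom A Y d
  using rpo_groups rpo_homs by (intro group_hom.intro group_hom_axioms.intro) (auto simp: rpo_group_def rpo_hom_def)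

sublocale e: group_hom Y A e
  using rpo_groups rpo_homs by (intro group_hom.intro group_hom_axioms.intro) (auto simp: rpo_group_def rpo_hom_def)

sublocale k: group_hom X A k
  using rpo_group_X rpo_groups S_split_ext
  by (intro group_hom.intro group_hom_axioms.intro) (auto simp: rpo_group_def S_split_ext_iff)

lemma d_e [simp]: "y \<in> carrier Y \<Longrightarrow> d (e y) = y"
  using schreier by (simp add: schreier_split_epi_def)

lemma k_in_kernel: "x \<in> carrier X \<Longrightarrow> k x \<in> kernel A Y d"
  using S_split_ext rpo_group_X by (auto simp: S_split_ext_iff)

lemma d_k [simp]: "x \<in> carrier X \<Longrightarrow> d (k x) = \<one>\<^bsub>Y\<^esub>"
  using k_in_kernel by (auto simp: kernel_def)

lemma k_surj: "\<lbrakk>a \<in> carrier A; d a = \<one>\<^bsub>Y\<^esub>\<rbrakk> \<Longrightarrow> \<exists>x\<in>carrier X. a = k x"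
  using S_split_ext rpo_group_X by (auto simp: S_split_ext_iff kernel_def image_iff set_eq_iff)

lemma k_inj: "inj_on k (carrier X)"
  using S_split_ext rpo_group_X by (simp add: S_split_ext_iff)

lemma k_eq_iff [simp]: "\<lbrakk>x \<in> carrier X; x' \<in> carrier X\<rbrakk> \<Longrightarrow> k x = k x' \<longleftrightarrow> x = x'"
  using k_inj by (auto simp: inj_on_def)

lemma k_pos_iff [simp]: "x \<in> carrier X \<Longrightarrow> k x \<in> pos A \<longleftrightarrow> x \<in> pos X"
  using S_split_ext rpo_group_X by (simp add: S_split_ext_iff)

lemma schreier_pos: "a \<in> pos A \<Longrightarrow> a \<otimes>\<^bsub>A\<^esub> inv\<^bsub>A\<^esub> (e (d a)) \<in> pos A"
  using schreier by (simp add: schreier_split_epi_def)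

text \<open>With \<open>y = d a\<close>, the difference \<open>a - e (d a)\<close> is killed by
  \<open>d\<close>, hence comes from \<open>X\<close>.\<close>

lemma decompose:
  assumes a: "a \<in> carrier A"
  obtains x y where "x \<in> carrier X" "y \<in> carrier Y" "a = k x \<otimes>\<^bsub>A\<^esub> e y"
proof -
  have "d (a \<otimes>\<^bsub>A\<^esub> inv\<^bsub>A\<^esub> (e (d a))) = \<one>\<^bsub>Y\<^esub>"
    using a by simp
  then obtain x where "x \<in> carrier X" "a \<otimes>\<^bsub>A\<^esub> inv\<^bsub>A\<^esub> (e (d a)) = k x"
    using k_surj a by (metis d.G.inv_closed d.G.m_closed d.hom_closed e.hom_closed)
  then show thesis
    using a that[of x "d a"] by (simp add: d.G.inv_solve_right')
qed

lemma d_comb [simp]: "\<lbrakk>x \<in> carrier X; y \<in> carrier Y\<rbrakk> \<Longrightarrow> d (k x \<otimes>\<^bsub>A\<^esub> e y) = y"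
  by simp

text \<open>Applying \<open>d\<close> recovers \<open>y\<close>; cancelling \<open>e y\<close> then
  leaves injectivity of \<open>k\<close>.\<close>

lemma comb_eq_iff [simp]:
  assumes "x \<in> carrier X" "y \<in> carrier Y" "x' \<in> carrier X" "y' \<in> carrier Y"
  shows "k x \<otimes>\<^bsub>A\<^esub> e y = k x' \<otimes>\<^bsub>A\<^esub> e y' \<longleftrightarrow> x = x' \<and> y = y'"
proof
  assume eq: "k x \<otimes>\<^bsub>A\<^esub> e y = k x' \<otimes>\<^bsub>A\<^esub> e y'"
  then have "y = y'"
    using assms d_comb by metis
  with eq assms show "x = x' \<and> y = y'"
    by simp
qed simp

text \<open>Forwards, \<open>d\<close> preserves positivity, and the Schreier condition strips off
  \<open>e y\<close> to leave a positive \<open>k x\<close>. The converse only adds positive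
  elements. The cone of \<open>A\<close> is therefore determined by those of \<open>X\<close> and
  \<open>Y\<close>.\<close>

lemma comb_pos_iff:
  assumes "x \<in> carrier X" "y \<in> carrier Y"
  shows "k x \<otimes>\<^bsub>A\<^esub> e y \<in> pos A \<longleftrightarrow> x \<in> pos X \<and> y \<in> pos Y"
proof
  assume pos: "k x \<otimes>\<^bsub>A\<^esub> e y \<in> pos A"
  then have "y \<in> pos Y"
    using rpo_homD(3)[OF rpo_homs(1) pos] assms by simp
  moreover have "k x \<in> pos A"
    using schreier_pos[OF pos] assms by (simp add: d.G.m_assoc)
  ultimately show "x \<in> pos X \<and> y \<in> pos Y"
    using assms by simp
next
  assume "x \<in> pos X \<and> y \<in> pos Y"
  then show "k x \<otimes>\<^bsub>A\<^esub> e y \<in> pos A"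
    using assms rpo_homD(3)[OF rpo_homs(2)] by (intro A.m_closed) auto
qed

text \<open>The conjugate of \<open>k x\<close> by \<open>e y\<close> is killed by \<open>d\<close>,
  so it lies in the image of \<open>k\<close>, where \<open>inv_into\<close> is meaningful. The
  commutation law avoids inverses and is the form used in later computations.\<close>

lemma action_commute:
  assumes "x \<in> carrier X" "y \<in> carrier Y"
  shows "ext_action X Y E y x \<in> carrier X"
    and "k (ext_action X Y E y x) \<otimes>\<^bsub>A\<^esub> e y = e y \<otimes>\<^bsub>A\<^esub> k x"
proof -
  let ?c = "e y \<otimes>\<^bsub>A\<^esub> k x \<otimes>\<^bsub>A\<^esub> inv\<^bsub>A\<^esub> (e y)"
  have c: "?c \<in> carrier A" "d ?c = \<one>\<^bsub>Y\<^esub>"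
    using assms by auto
  then have "?c \<in> k ` carrier X"
    using k_surj by blast
  then have "ext_action X Y E y x \<in> carrier X" "k (ext_action X Y E y x) = ?c"
    using assms by (auto simp: ext_action_def inv_into_into f_inv_into_f)
  then show "ext_action X Y E y x \<in> carrier X"
    "k (ext_action X Y E y x) \<otimes>\<^bsub>A\<^esub> e y = e y \<otimes>\<^bsub>A\<^esub> k x"
    using assms by (auto simp: d.G.m_assoc)
qed

text \<open>Uniqueness of decompositions leaves only one \<open>z\<close> that can satisfy the
  commutation law.\<close>

lemma action_eqI:
  assumes "x \<in> carrier X" "y \<in> carrier Y" "z \<in> carrier X" "k z \<otimes>\<^bsub>A\<^esub> e y = e y \<otimes>\<^bsub>A\<^esub> k x"
  shows "ext_action X Y E y x = z"
  using assms action_commute by (metis comb_eq_iff)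

text \<open>Moving \<open>k x'\<close> past \<open>e y\<close> gives the semidirect product law:
  besides \<open>X\<close> and \<open>Y\<close>, the multiplication depends on the action
  alone.\<close>

lemma comb_mult:
  assumes "x \<in> carrier X" "y \<in> carrier Y" "x' \<in> carrier X" "y' \<in> carrier Y"
  shows "(k x \<otimes>\<^bsub>A\<^esub> e y) \<otimes>\<^bsub>A\<^esub> (k x' \<otimes>\<^bsub>A\<^esub> e y') =
    k (x \<otimes>\<^bsub>X\<^esub> ext_action X Y E y x') \<otimes>\<^bsub>A\<^esub> e (y \<otimes>\<^bsub>Y\<^esub> y')"
proof -
  have "(k x \<otimes>\<^bsub>A\<^esub> e y) \<otimes>\<^bsub>A\<^esub> (k x' \<otimes>\<^bsub>A\<^esub> e y') = k x \<otimes>\<^bsub>A\<^esub> (e y \<otimes>\<^bsub>A\<^esub> k x') \<otimes>\<^bsub>A\<^esub> e y'"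
    using assms by (simp add: d.G.m_assoc)
  also have "\<dots> = k x \<otimes>\<^bsub>A\<^esub> (k (ext_action X Y E y x') \<otimes>\<^bsub>A\<^esub> e y) \<otimes>\<^bsub>A\<^esub> e y'"
    using assms action_commute by simp
  also have "\<dots> = k (x \<otimes>\<^bsub>X\<^esub> ext_action X Y E y x') \<otimes>\<^bsub>A\<^esub> e (y \<otimes>\<^bsub>Y\<^esub> y')"
    using assms action_commute(1) by (simp add: d.G.m_assoc)
  finally show ?thesis .
qed

text \<open>Each algebraic law reduces by \<open>action_eqI\<close> to moving a section element past
  elements of the kernel; positivity is read off from \<open>comb_pos_iff\<close>.\<close>

lemma action_rpo_hom: "ext_action X Y E \<in> rpo_hom Y (rpo_Aut X)"
proof -
  let ?\<phi> = "ext_action X Y E"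
  have ext: "?\<phi> y \<in> extensional (carrier X)" if "y \<in> carrier Y" for y
    using that by (simp add: ext_action_def)
  have "?\<phi> y (x \<otimes>\<^bsub>X\<^esub> x') = ?\<phi> y x \<otimes>\<^bsub>X\<^esub> ?\<phi> y x'"
    if "x \<in> carrier X" "x' \<in> carrier X" "y \<in> carrier Y" for x x' y
  proof (rule action_eqI)
    have "k (?\<phi> y x \<otimes>\<^bsub>X\<^esub> ?\<phi> y x') \<otimes>\<^bsub>A\<^esub> e y = k (?\<phi> y x) \<otimes>\<^bsub>A\<^esub> (k (?\<phi> y x') \<otimes>\<^bsub>A\<^esub> e y)"
      using that action_commute(1) by (simp add: d.G.m_assoc)
    also have "\<dots> = (k (?\<phi> y x) \<otimes>\<^bsub>A\<^esub> e y) \<otimes>\<^bsub>A\<^esub> k x'"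
      using that action_commute(1) action_commute(2)[of x' y] by (simp add: d.G.m_assoc)
    also have "\<dots> = (e y \<otimes>\<^bsub>A\<^esub> k x) \<otimes>\<^bsub>A\<^esub> k x'"
      using that action_commute by simp
    also have "\<dots> = e y \<otimes>\<^bsub>A\<^esub> k (x \<otimes>\<^bsub>X\<^esub> x')"
      using that by (simp add: d.G.m_assoc)
    finally show "k (?\<phi> y x \<otimes>\<^bsub>X\<^esub> ?\<phi> y x') \<otimes>\<^bsub>A\<^esub> e y = e y \<otimes>\<^bsub>A\<^esub> k (x \<otimes>\<^bsub>X\<^esub> x')" .
  qed (use that action_commute(1) in auto)
  then have hom: "?\<phi> y \<in> hom X X" if "y \<in> carrier Y" for y
    using that action_commute(1) by (auto intro!: homI)
  have mult: "?\<phi> (y \<otimes>\<^bsub>Y\<^esub> z) = compose (carrier X) (?\<phi> y) (?\<phi> z)"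
    if "y \<in> carrier Y" "z \<in> carrier Y" for y z
  proof (rule extensionalityI)
    fix x assume x: "x \<in> carrier X"
    show "?\<phi> (y \<otimes>\<^bsub>Y\<^esub> z) x = compose (carrier X) (?\<phi> y) (?\<phi> z) x"
      unfolding compose_eq[OF x]
    proof (rule action_eqI)
      have "k (?\<phi> y (?\<phi> z x)) \<otimes>\<^bsub>A\<^esub> e (y \<otimes>\<^bsub>Y\<^esub> z) = (k (?\<phi> y (?\<phi> z x)) \<otimes>\<^bsub>A\<^esub> e y) \<otimes>\<^bsub>A\<^esub> e z"
        using that x action_commute(1) by (simp add: d.G.m_assoc)
      also have "\<dots> = e y \<otimes>\<^bsub>A\<^esub> (k (?\<phi> z x) \<otimes>\<^bsub>A\<^esub> e z)"
        using that x action_commute by (simp add: d.G.m_assoc)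
      also have "\<dots> = e y \<otimes>\<^bsub>A\<^esub> (e z \<otimes>\<^bsub>A\<^esub> k x)"
        using that x action_commute by simp
      also have "\<dots> = e (y \<otimes>\<^bsub>Y\<^esub> z) \<otimes>\<^bsub>A\<^esub> k x"
        using that x by (simp add: d.G.m_assoc)
      finally show "k (?\<phi> y (?\<phi> z x)) \<otimes>\<^bsub>A\<^esub> e (y \<otimes>\<^bsub>Y\<^esub> z) = e (y \<otimes>\<^bsub>Y\<^esub> z) \<otimes>\<^bsub>A\<^esub> k x" .
    qed (use that x action_commute(1) in auto)
  qed (use that ext in auto)
  have one: "?\<phi> \<one>\<^bsub>Y\<^esub> = (\<lambda>x\<in>carrier X. x)"
    by (rule extensionalityI[where A = "carrier X"]) (auto simp: ext intro!: action_eqI)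
  have pos: "?\<phi> y x \<in> pos X" if "y \<in> pos Y" "x \<in> pos X" for y x
  proof -
    have xy: "x \<in> carrier X" "y \<in> carrier Y"
      using that X.subset Y.subset by auto
    then have "e y \<otimes>\<^bsub>A\<^esub> k x \<in> pos A"
      using that rpo_homD(3)[OF rpo_homs(2)] by (intro A.m_closed) auto
    then show ?thesis
      using xy action_commute comb_pos_iff by metis
  qed
  show ?thesis
    using ext hom mult one pos
    by (auto simp: rpo_hom_Aut_iff rpo_group_X rpo_groups ext_action_def)
qed

text \<open>Identifies the action of a concrete extension without inverting \<open>k\<close>;
  applied to isomorphic extensions, semidirect products and pullbacks.\<close>

lemma ext_action_eq:
  assumes "\<phi> \<in> rpo_hom Y (rpo_Aut X)"
    and "\<And>x y. \<lbrakk>x \<in> carrier X; y \<in> carrier Y\<rbrakk> \<Longrightarrow> k (\<phi> y x) \<otimes>\<^bsub>A\<^esub> e y = e y \<otimes>\<^bsub>A\<^esub> k x"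
  shows "ext_action X Y E = \<phi>"
  using rpo_group_X rpo_groups(2) action_rpo_hom assms
  by (intro rpo_hom_Aut_eqI action_eqI) (auto intro: rpo_hom_AutD(1))

end

text \<open>An isomorphism transports the commutation law, hence the action. Conversely, if the
  actions agree, matching the decompositions in \<open>E\<close> and \<open>F\<close> respects
  products by \<open>comb_mult\<close> and cones by \<open>comb_pos_iff\<close>. The middle objects
  may have different carrier types, so a pullback can be compared with an extension living in
  \<open>'a\<close>.\<close>

lemma ext_isomorphic_iff:
  assumes X: "rpo_group X" and SE: "S_split_ext X Y E" and SF: "S_split_ext X Y F"
  shows "ext_isomorphic X Y E F \<longleftrightarrow> ext_action X Y E = ext_action X Y F"
proof -
  interpret E: schreier_ext X Y E by (intro schreier_ext.intro X SE)
  interpret F: schreier_ext X Y F by (intro schreier_ext.intro X SF)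
  have iso_iff: "h \<in> rpo_iso E.A F.A \<longleftrightarrow>
    h \<in> hom E.A F.A \<and> h \<in> extensional (carrier E.A) \<and> bij_betw h (carrier E.A) (carrier F.A) \<and>
    (\<forall>a\<in>carrier E.A. h a \<in> pos F.A \<longleftrightarrow> a \<in> pos E.A)" for h
    using E.d.G.group_axioms E.A.subset F.A.subset by (rule rpo_iso_iff)
  show ?thesis
  proof
    assume "ext_isomorphic X Y E F"
    then obtain h where "h \<in> rpo_iso E.A F.A"
      and e: "\<And>y. y \<in> carrier Y \<Longrightarrow> h (E.e y) = F.e y"
      and k: "\<And>x. x \<in> carrier X \<Longrightarrow> h (E.k x) = F.k x"
      unfolding ext_isomorphic_def by blast
    then have h: "h \<in> hom E.A F.A"
      using iso_iff by blast
    show "ext_action X Y E = ext_action X Y F"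
    \<comment> \<open>It remains to verify the commutation law in \<open>F\<close> for the action of
      \<open>E\<close>, which is the image under \<open>h\<close> of the law in
      \<open>E\<close>.\<close>
    proof (rule F.ext_action_eq[symmetric, OF E.action_rpo_hom])
      fix x y assume xy: "x \<in> carrier X" "y \<in> carrier Y"
      note c = E.action_commute[OF xy]
      have "F.k (ext_action X Y E y x) \<otimes>\<^bsub>F.A\<^esub> F.e y = h (E.k (ext_action X Y E y x) \<otimes>\<^bsub>E.A\<^esub> E.e y)"
        using xy c(1) e k by (simp add: hom_mult[OF h])
      also have "\<dots> = F.e y \<otimes>\<^bsub>F.A\<^esub> F.k x"
        unfolding c(2) using xy e k by (simp add: hom_mult[OF h])
      finally show "F.k (ext_action X Y E y x) \<otimes>\<^bsub>F.A\<^esub> F.e y = F.e y \<otimes>\<^bsub>F.A\<^esub> F.k x" .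
    qed
  next
    assume eq: "ext_action X Y E = ext_action X Y F"
    \<comment> \<open>The coordinates of \<open>a\<close> are recovered explicitly: \<open>y\<close>
      is \<open>d a\<close>, and \<open>x\<close> is the preimage of
      \<open>a - e (d a)\<close>.\<close>
    define h where "h = (\<lambda>a\<in>carrier E.A. F.k (inv_into (carrier X) E.k (a \<otimes>\<^bsub>E.A\<^esub> inv\<^bsub>E.A\<^esub> (E.e (E.d a))))
      \<otimes>\<^bsub>F.A\<^esub> F.e (E.d a))"
    have h: "h (E.k x \<otimes>\<^bsub>E.A\<^esub> E.e y) = F.k x \<otimes>\<^bsub>F.A\<^esub> F.e y" if "x \<in> carrier X" "y \<in> carrier Y" for x y
      using that E.k_inj by (simp add: h_def E.d.G.m_assoc)
    have "h \<in> hom E.A F.A"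
    proof (rule homI)
      fix a b assume "a \<in> carrier E.A" "b \<in> carrier E.A"
      then obtain x y x' y' where xy: "x \<in> carrier X" "y \<in> carrier Y" "a = E.k x \<otimes>\<^bsub>E.A\<^esub> E.e y"
        "x' \<in> carrier X" "y' \<in> carrier Y" "b = E.k x' \<otimes>\<^bsub>E.A\<^esub> E.e y'"
        by (metis E.decompose)
      then show "h (a \<otimes>\<^bsub>E.A\<^esub> b) = h a \<otimes>\<^bsub>F.A\<^esub> h b"
        using E.action_commute(1)[of x' y]
        by (simp only: E.comb_mult F.comb_mult h E.k.G.m_closed E.d.H.m_closed eq)
    next
      fix a assume "a \<in> carrier E.A"
      then show "h a \<in> carrier F.A"
        by (rule E.decompose) (simp add: h)
    qed
    moreover have "bij_betw h (carrier E.A) (carrier F.A)"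
      unfolding bij_betw_def
    proof
      show "inj_on h (carrier E.A)"
      proof (rule inj_onI)
        fix a b assume "a \<in> carrier E.A" "b \<in> carrier E.A" "h a = h b"
        then show "a = b"
          by (elim E.decompose) (simp add: h)
      qed
      show "h ` carrier E.A = carrier F.A"
      proof
        show "h ` carrier E.A \<subseteq> carrier F.A"
          using \<open>h \<in> hom E.A F.A\<close> by (auto simp: hom_def)
        show "carrier F.A \<subseteq> h ` carrier E.A"
        proof
          fix a assume "a \<in> carrier F.A"
          then obtain x y where xy: "x \<in> carrier X" "y \<in> carrier Y" "a = F.k x \<otimes>\<^bsub>F.A\<^esub> F.e y"
            by (rule F.decompose)
          then show "a \<in> h ` carrier E.A"
            by (intro image_eqI[of _ _ "E.k x \<otimes>\<^bsub>E.A\<^esub> E.e y"]) (auto simp: h)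
        qed
      qed
    qed
    moreover have "h a \<in> pos F.A \<longleftrightarrow> a \<in> pos E.A" if "a \<in> carrier E.A" for a
      using that by (rule E.decompose) (simp add: h E.comb_pos_iff F.comb_pos_iff)
    ultimately have "h \<in> rpo_iso E.A F.A"
      \<comment> \<open>After the first simplification only extensionality of \<open>h\<close> is
        left, and this needs its definition.\<close>
      by (simp add: iso_iff) (simp add: h_def)
    moreover have "F.d (h a) = E.d a" if "a \<in> carrier E.A" for a
      using that by (rule E.decompose) (simp add: h)
    moreover have "h (E.e y) = F.e y" if "y \<in> carrier Y" for y
      using h[of "\<one>\<^bsub>X\<^esub>" y] that by simp
    moreover have "h (E.k x) = F.k x" if "x \<in> carrier X" for x
      using h[of x "\<one>\<^bsub>Y\<^esub>"] that by simp
    ultimately show "ext_isomorphic X Y E F"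
      unfolding ext_isomorphic_def by blast
  qed
qed


section \<open>Semidirect products\<close>

text \<open>The injection \<open>\<iota>\<close> encodes pairs in \<open>'a\<close>, the type over
  which \<open>S_Pt\<close> lets middle objects range; \<open>the_inv \<iota>\<close> decodes them.
  Product and cone copy \<open>comb_mult\<close> and \<open>comb_pos_iff\<close>.\<close>

definition semidirect_ext :: "('x \<times> 'y \<Rightarrow> 'a) \<Rightarrow> 'x rpogrp \<Rightarrow> 'y rpogrp \<Rightarrow> ('y \<Rightarrow> 'x \<Rightarrow> 'x) \<Rightarrow>
    ('x, 'y, 'a) split_ext" where
  "semidirect_ext \<iota> X Y \<phi> =
     \<lparr>mid = \<lparr>carrier = \<iota> ` (carrier X \<times> carrier Y),
        mult = (\<lambda>a b. \<iota> (fst (the_inv \<iota> a) \<otimes>\<^bsub>X\<^esub> \<phi> (snd (the_inv \<iota> a)) (fst (the_inv \<iota> b)),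
          snd (the_inv \<iota> a) \<otimes>\<^bsub>Y\<^esub> snd (the_inv \<iota> b))),
        one = \<iota> (\<one>\<^bsub>X\<^esub>, \<one>\<^bsub>Y\<^esub>),
        pos = \<iota> ` (pos X \<times> pos Y)\<rparr>,
      proj = (\<lambda>a\<in>\<iota> ` (carrier X \<times> carrier Y). snd (the_inv \<iota> a)),
      sec = (\<lambda>y\<in>carrier Y. \<iota> (\<one>\<^bsub>X\<^esub>, y)),
      incl = (\<lambda>x\<in>carrier X. \<iota> (x, \<one>\<^bsub>Y\<^esub>))\<rparr>"

text \<open>The cone is closed under addition because \<open>\<phi> y\<close> preserves
  \<open>pos X\<close> for positive \<open>y\<close>. The Schreier condition comes from
  \<open>(x, y) = (x, 0) + (0, y)\<close>, and the action from
  \<open>(0, y) + (x, 0) = (\<phi> y x, y)\<close>.\<close>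

lemma
  assumes \<iota>: "inj \<iota>" and X: "rpo_group X" and Y: "rpo_group Y" and \<phi>: "\<phi> \<in> rpo_hom Y (rpo_Aut X)"
  shows S_split_ext_semidirect: "S_split_ext X Y (semidirect_ext \<iota> X Y \<phi>)" (is "S_split_ext X Y ?E")
    and ext_action_semidirect: "ext_action X Y (semidirect_ext \<iota> X Y \<phi>) = \<phi>"
proof -
  interpret X: group X using X by (simp add: rpo_group_def)
  interpret Y: group Y using Y by (simp add: rpo_group_def)
  interpret PX: submonoid "pos X" X using X by (simp add: rpo_group_def)
  interpret PY: submonoid "pos Y" Y using Y by (simp add: rpo_group_def)
  note AutD [simp] = rpo_hom_AutD[OF X Y \<phi>]
  have [simp]: "the_inv \<iota> (\<iota> p) = p" for p
    using \<iota> by (rule the_inv_f_f)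
  have \<iota>_mem [simp]: "\<iota> p \<in> \<iota> ` S \<longleftrightarrow> p \<in> S" for p S
    using \<iota> by (rule inj_image_mem_iff)
  have \<iota>_eq [simp]: "\<iota> p = \<iota> q \<longleftrightarrow> p = q" for p q
    using \<iota> by (rule inj_eq)
  have pos_carrier [simp]: "x \<in> pos X \<Longrightarrow> x \<in> carrier X" "y \<in> pos Y \<Longrightarrow> y \<in> carrier Y" for x y
    using PX.subset PY.subset by auto
  have group: "group (mid ?E)"
  proof (rule groupI)
    fix a assume "a \<in> carrier (mid ?E)"
    then obtain x y where xy: "a = \<iota> (x, y)" "x \<in> carrier X" "y \<in> carrier Y"
      by (auto simp: semidirect_ext_def)
    \<comment> \<open>In \<open>?b + a\<close> the first coordinates add up to
      \<open>\<phi> (-y)\<close> applied to \<open>-x + x\<close>; additivity is used from right to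
      left to merge them.\<close>
    let ?b = "\<iota> (\<phi> (inv\<^bsub>Y\<^esub> y) (inv\<^bsub>X\<^esub> x), inv\<^bsub>Y\<^esub> y)"
    have "?b \<otimes>\<^bsub>mid ?E\<^esub> a = \<one>\<^bsub>mid ?E\<^esub>"
      using xy AutD(2)[of "inv\<^bsub>Y\<^esub> y" "inv\<^bsub>X\<^esub> x" x, symmetric] by (simp add: semidirect_ext_def del: AutD(2))
    then show "\<exists>b\<in>carrier (mid ?E). b \<otimes>\<^bsub>mid ?E\<^esub> a = \<one>\<^bsub>mid ?E\<^esub>"
      using xy by (intro bexI[of _ ?b]) (auto simp: semidirect_ext_def)
  qed (auto simp: semidirect_ext_def X.m_assoc Y.m_assoc)
  have rpo: "rpo_group (mid ?E)"
    by (intro rpo_groupI[OF group] submonoid.intro) (auto simp: semidirect_ext_def)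
  show S: "S_split_ext X Y ?E"
  proof (rule S_split_extI[OF X rpo Y])
    show "proj ?E \<in> rpo_hom (mid ?E) Y"
      by (auto intro!: rpo_homI homI simp: semidirect_ext_def)
    show "sec ?E \<in> rpo_hom Y (mid ?E)"
      by (auto intro!: rpo_homI homI simp: semidirect_ext_def)
    show "\<exists>p\<in>pos (mid ?E). a = p \<otimes>\<^bsub>mid ?E\<^esub> sec ?E (proj ?E a)" if a: "a \<in> pos (mid ?E)" for a
    proof -
      obtain x y where xy: "a = \<iota> (x, y)" "x \<in> pos X" "y \<in> pos Y"
        using a by (auto simp: semidirect_ext_def)
      then show ?thesis
        by (intro bexI[of _ "\<iota> (x, \<one>\<^bsub>Y\<^esub>)"]) (auto simp: semidirect_ext_def)
    qed
    show "incl ?E \<in> hom X (mid ?E)"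
      by (auto intro!: homI simp: semidirect_ext_def)
    show "\<exists>x\<in>carrier X. a = incl ?E x" if "a \<in> carrier (mid ?E)" "proj ?E a = \<one>\<^bsub>Y\<^esub>" for a
      using that by (auto simp: semidirect_ext_def)
  qed (auto simp: semidirect_ext_def inj_on_def)
  interpret schreier_ext X Y ?E
    by (intro schreier_ext.intro X S)
  show "ext_action X Y ?E = \<phi>"
    by (rule ext_action_eq[OF \<phi>]) (simp add: semidirect_ext_def)
qed


section \<open>Pullbacks\<close>

text \<open>The section sends \<open>z\<close> to \<open>(z, e (f z))\<close>, and kernel elements
  have first coordinate 0. Conjugation therefore happens in \<open>A\<close> by
  \<open>e (f z)\<close>, which is the old action at \<open>f z\<close>.\<close>

lemma
  assumes X: "rpo_group X" and Z: "rpo_group Z" and f: "f \<in> rpo_hom Z Y" and E: "S_split_ext X Y E"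
  shows S_split_ext_pullback: "S_split_ext X Z (ext_pullback X Z f E)" (is "S_split_ext X Z ?P")
    and ext_action_pullback: "ext_action X Z (ext_pullback X Z f E) = hom_map Z Y f (ext_action X Y E)"
proof -
  interpret schreier_ext X Y E by (intro schreier_ext.intro X E)
  interpret Z: group Z using Z by (simp add: rpo_group_def)
  interpret PZ: submonoid "pos Z" Z using Z by (simp add: rpo_group_def)
  interpret f: group_hom Z Y f
    using f by (intro group_hom.intro group_hom_axioms.intro Z.group_axioms d.H.group_axioms rpo_homD(1))
  have pos_carrier [simp]: "z \<in> pos Z \<Longrightarrow> z \<in> carrier Z" "a \<in> pos A \<Longrightarrow> a \<in> carrier A" for z a
    using PZ.subset A.subset by auto
  have e_pos [simp]: "y \<in> pos Y \<Longrightarrow> e y \<in> pos A" and f_pos [simp]: "z \<in> pos Z \<Longrightarrow> f z \<in> pos Y" for y z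
    using rpo_homD(3)[OF rpo_homs(2)] rpo_homD(3)[OF f] by blast+
  note defs = ext_pullback_def rpo_pullback_def DirProd_def Let_def
  have group: "group (mid ?P)"
  proof (rule groupI)
    fix p assume "p \<in> carrier (mid ?P)"
    then show "\<exists>q\<in>carrier (mid ?P). q \<otimes>\<^bsub>mid ?P\<^esub> p = \<one>\<^bsub>mid ?P\<^esub>"
      by (intro bexI[of _ "(inv\<^bsub>Z\<^esub> (fst p), inv\<^bsub>A\<^esub> (snd p))"]) (auto simp: defs)
  qed (auto simp: defs Z.m_assoc d.G.m_assoc)
  have rpo: "rpo_group (mid ?P)"
    by (intro rpo_groupI[OF group] submonoid.intro) (auto simp: defs)
  show S: "S_split_ext X Z ?P"
  proof (rule S_split_extI[OF X rpo Z])
    show "proj ?P \<in> rpo_hom (mid ?P) Z" "sec ?P \<in> rpo_hom Z (mid ?P)"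
      by (auto intro!: rpo_homI homI simp: defs)
    show "\<exists>q\<in>pos (mid ?P). p = q \<otimes>\<^bsub>mid ?P\<^esub> sec ?P (proj ?P p)" if p: "p \<in> pos (mid ?P)" for p
    proof -
      obtain z a where za: "p = (z, a)" "z \<in> pos Z" "a \<in> pos A" "f z = d a"
        using p by (auto simp: defs)
      \<comment> \<open>The witness pairs 0 with the Schreier difference of \<open>a\<close>; adding
        the section at \<open>z\<close> returns \<open>(z, a)\<close> because
        \<open>f z = d a\<close>.\<close>
      then show ?thesis
        using schreier_pos[of a]
        by (intro bexI[of _ "(\<one>\<^bsub>Z\<^esub>, a \<otimes>\<^bsub>A\<^esub> inv\<^bsub>A\<^esub> (e (d a)))"]) (auto simp: defs d.G.m_assoc)
    qed
    show "incl ?P \<in> hom X (mid ?P)"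
      by (auto intro!: homI simp: defs)
    show "\<exists>x\<in>carrier X. p = incl ?P x" if "p \<in> carrier (mid ?P)" "proj ?P p = \<one>\<^bsub>Z\<^esub>" for p
      using that k_surj by (fastforce simp: defs)
  qed (auto simp: defs inj_on_def)
  interpret P: schreier_ext X Z ?P
    by (intro schreier_ext.intro X S)
  have "hom_map Z Y f (ext_action X Y E) \<in> rpo_hom Z (rpo_Aut X)"
    using rpo_hom_compose[OF Z f action_rpo_hom] by (simp add: hom_map_def)
  then show "ext_action X Z ?P = hom_map Z Y f (ext_action X Y E)"
    by (rule P.ext_action_eq) (simp add: defs hom_map_def compose_eq action_commute)
qed


section \<open>Representability\<close>

text \<open>The fibre of \<open>ext_action\<close> over \<open>\<phi>\<close>. By
  \<open>ext_isomorphic_iff\<close>, nonempty fibres are exactly the isomorphism classes.\<close>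

definition action_class :: "'x rpogrp \<Rightarrow> 'y rpogrp \<Rightarrow> ('y \<Rightarrow> 'x \<Rightarrow> 'x) \<Rightarrow> ('x, 'y, 'a) split_ext set" where
  "action_class X Y \<phi> = {E. S_split_ext X Y E \<and> ext_action X Y E = \<phi>}"

text \<open>Makes every fibre over a morphism nonempty, as the descriptions of \<open>S_Pt\<close>
  and \<open>S_Pt_map\<close> by actions require.\<close>

lemma semidirect_in_action_class:
  assumes "inj \<iota>" "rpo_group X" "rpo_group Y" "\<phi> \<in> rpo_hom Y (rpo_Aut X)"
  shows "semidirect_ext \<iota> X Y \<phi> \<in> action_class X Y \<phi>"
  using assms by (simp add: action_class_def S_split_ext_semidirect ext_action_semidirect)

text \<open>The class of \<open>E\<close> is the fibre over its action, and semidirect products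
  realise every morphism as an action.\<close>

lemma S_Pt_eq:
  fixes \<iota> :: "'x \<times> 'y \<Rightarrow> 'a"
  assumes \<iota>: "inj \<iota>" and X: "rpo_group X" and Y: "rpo_group Y"
  shows "(S_Pt X Y :: ('x, 'y, 'a) split_ext set set) = action_class X Y ` rpo_hom Y (rpo_Aut X)"
proof -
  let ?S = "{E :: ('x, 'y, 'a) split_ext. S_split_ext X Y E}"
  let ?R = "{(E :: ('x, 'y, 'a) split_ext, F :: ('x, 'y, 'a) split_ext).
    S_split_ext X Y E \<and> S_split_ext X Y F \<and> ext_isomorphic X Y E F}"
  have "?R `` {E} = action_class X Y (ext_action X Y E)" if "E \<in> ?S" for E
    using that X by (auto simp: action_class_def ext_isomorphic_iff)
  then have "(S_Pt X Y :: ('x, 'y, 'a) split_ext set set) = (\<lambda>E. action_class X Y (ext_action X Y E)) ` ?S"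
    unfolding S_Pt_def quotient_def UNION_singleton_eq_range by (rule image_cong[OF refl])
  also have "\<dots> = action_class X Y ` (ext_action X Y ` ?S)"
    by (simp only: image_image)
  also have "ext_action X Y ` ?S = rpo_hom Y (rpo_Aut X)"
  proof
    show "ext_action X Y ` ?S \<subseteq> rpo_hom Y (rpo_Aut X)"
      using X by (auto intro: schreier_ext.action_rpo_hom schreier_ext.intro)
    show "rpo_hom Y (rpo_Aut X) \<subseteq> ext_action X Y ` ?S"
    proof
      fix \<phi> assume "\<phi> \<in> rpo_hom Y (rpo_Aut X)"
      then show "\<phi> \<in> ext_action X Y ` ?S"
        using semidirect_in_action_class[OF \<iota> X Y]
        by (intro image_eqI[of _ _ "semidirect_ext \<iota> X Y \<phi>"]) (auto simp: action_class_def)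
    qed
  qed
  finally show ?thesis .
qed

text \<open>Distinct fibres are disjoint, and none of those considered is empty: the semidirect
  product in a fibre determines its action.\<close>

lemma inj_on_action_class:
  fixes \<iota> :: "'x \<times> 'y \<Rightarrow> 'a"
  assumes "inj \<iota>" "rpo_group X" "rpo_group Y"
  shows "inj_on (action_class X Y :: _ \<Rightarrow> ('x, 'y, 'a) split_ext set) (rpo_hom Y (rpo_Aut X))"
proof (rule inj_onI)
  fix \<phi> \<psi>
  assume "\<phi> \<in> rpo_hom Y (rpo_Aut X)"
    and "(action_class X Y \<phi> :: ('x, 'y, 'a) split_ext set) = action_class X Y \<psi>"
  then show "\<phi> = \<psi>"
    using semidirect_in_action_class[OF assms, of \<phi>] by (auto simp: action_class_def)
qed

text \<open>All members of the class have pullbacks with the same action, so the choice of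
  \<open>E\<close> is immaterial; the semidirect product supplies one such \<open>E\<close>.\<close>

lemma S_Pt_map_action_class:
  fixes \<iota> :: "'x \<times> 'y \<Rightarrow> 'a"
  assumes \<iota>: "inj \<iota>" and X: "rpo_group X" and Z: "rpo_group Z" and Y: "rpo_group Y"
    and f: "f \<in> rpo_hom Z Y" and \<phi>: "\<phi> \<in> rpo_hom Y (rpo_Aut X)"
  shows "S_Pt_map X Z Y f (action_class X Y \<phi> :: ('x, 'y, 'a) split_ext set) =
    action_class X Z (hom_map Z Y f \<phi>)"
proof -
  have "ext_isomorphic X Z E' (ext_pullback X Z f E) \<longleftrightarrow> ext_action X Z E' = hom_map Z Y f \<phi>"
    if "S_split_ext X Z E'" "E \<in> action_class X Y \<phi>" for E E' :: "('x, 'y, 'a) split_ext"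
    using that X Z f
    by (simp add: action_class_def ext_isomorphic_iff S_split_ext_pullback ext_action_pullback)
  then show ?thesis
    using semidirect_in_action_class[OF \<iota> X Y \<phi>]
    by (auto simp: S_Pt_map_def action_class_def[of X Z])
qed

section \<open>The representable presheaf and the natural isomorphism\<close>

lemma rpo_presheaf_Hom:
  "rpo_presheaf (\<lambda>Y :: 'y rpogrp. rpo_hom Y K) (\<lambda>Z Y. hom_map Z Y)"
proof
  fix Z Y :: "'y rpogrp" and f c
  assume "rpo_group Z" "rpo_group Y" "f \<in> rpo_hom Z Y" "c \<in> rpo_hom Y K"
  then show "hom_map Z Y f c \<in> rpo_hom Z K"
    by (simp add: hom_map_def rpo_hom_compose)
next
  fix Y :: "'y rpogrp" and c
  assume "rpo_group Y" "c \<in> rpo_hom Y K"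
  then show "hom_map Y Y (\<lambda>y\<in>carrier Y. y) c = c"
    using compose_Id[of c "carrier Y" "carrier K"] by (simp add: hom_map_def rpo_hom_def hom_def)
next
  fix W Z Y :: "'y rpogrp" and g f c
  assume "g \<in> rpo_hom W Z"
  then have "g \<in> carrier W \<rightarrow> carrier Z"
    by (simp add: rpo_hom_def hom_def)
  then show "hom_map W Y (compose (carrier W) f g) c = hom_map W Z g (hom_map Z Y f c)"
    by (simp add: hom_map_def compose_assoc)
qed

theorem mainTheorem11:
  fixes X :: "'x rpogrp"
    and \<iota> :: "'x \<times> 'y \<Rightarrow> 'a"
  assumes "rpo_group X"
    and "inj \<iota>"
  shows "\<exists>\<Phi> :: 'y rpogrp \<Rightarrow> ('x, 'y, 'a) split_ext set \<Rightarrow> ('y \<Rightarrow> 'x \<Rightarrow> 'x).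
    rpo_presheaf_iso
      (\<lambda>Y. S_Pt X Y) (\<lambda>Z Y. S_Pt_map X Z Y)
      (\<lambda>Y. rpo_hom Y (rpo_Aut X)) (\<lambda>Z Y. hom_map Z Y) \<Phi>"
proof -
  let ?H = "\<lambda>Y. rpo_hom Y (rpo_Aut X)"
  let ?C = "action_class X :: 'y rpogrp \<Rightarrow> _ \<Rightarrow> ('x, 'y, 'a) split_ext set"
  \<comment> \<open>Sends an isomorphism class to the action shared by its members.\<close>
  define \<Phi> where "\<Phi> = (\<lambda>Y. inv_into (?H Y) (?C Y))"
  interpret H: rpo_presheaf ?H "\<lambda>Z Y. hom_map Z Y"
    by (rule rpo_presheaf_Hom)
  note S_Pt = S_Pt_eq[OF assms(2,1)]
  note S_Pt_map = S_Pt_map_action_class[OF assms(2,1)]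
  note inj = inj_on_action_class[OF assms(2,1)]
  have id_hom: "(\<lambda>y\<in>carrier Y. y) \<in> rpo_hom Y Y" if Y: "rpo_group Y" for Y :: "'y rpogrp"
  proof -
    interpret rpo_group Y by fact
    show ?thesis
      using subset by (intro rpo_homI homI) (auto simp: monoid.m_closed)
  qed
  \<comment> \<open>Functoriality of \<open>S_Pt\<close> is carried over from the representable
    presheaf along \<open>action_class\<close>, so iterated pullbacks are never compared
    directly.\<close>
  have "rpo_presheaf_iso (\<lambda>Y. S_Pt X Y) (\<lambda>Z Y. S_Pt_map X Z Y) ?H (\<lambda>Z Y. hom_map Z Y) \<Phi>"
  proof unfold_locales
    fix Z Y :: "'y rpogrp" and f and c :: "('x, 'y, 'a) split_ext set"
    assume "rpo_group Z" "rpo_group Y" "f \<in> rpo_hom Z Y" "c \<in> S_Pt X Y"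
    then show "S_Pt_map X Z Y f c \<in> S_Pt X Z" "\<Phi> Z (S_Pt_map X Z Y f c) = hom_map Z Y f (\<Phi> Y c)"
      by (auto simp: S_Pt S_Pt_map H.map_closed \<Phi>_def inv_into_f_f[OF inj])
  next
    fix Y :: "'y rpogrp" and c :: "('x, 'y, 'a) split_ext set"
    assume "rpo_group Y" "c \<in> S_Pt X Y"
    then show "S_Pt_map X Y Y (\<lambda>y\<in>carrier Y. y) c = c"
      by (auto simp: S_Pt S_Pt_map id_hom H.map_id)
  next
    fix W Z Y :: "'y rpogrp" and g f and c :: "('x, 'y, 'a) split_ext set"
    assume "rpo_group W" "rpo_group Z" "rpo_group Y" "g \<in> rpo_hom W Z" "f \<in> rpo_hom Z Y" "c \<in> S_Pt X Y"
    then show "S_Pt_map X W Y (compose (carrier W) f g) c = S_Pt_map X W Z g (S_Pt_map X Z Y f c)"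
      by (auto simp: S_Pt S_Pt_map H.map_closed H.map_comp rpo_hom_compose)
  next
    fix Y :: "'y rpogrp" assume "rpo_group Y"
    then show "bij_betw (\<Phi> Y) (S_Pt X Y) (?H Y)"
      unfolding \<Phi>_def by (intro bij_betw_inv_into) (simp add: S_Pt inj_on_imp_bij_betw inj)
  qed
  then show ?thesis
    by (rule exI[of _ \<Phi>])
qed

end
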